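(* Let $V$ be a function holomorphic in a neighborhood of $0\in\mathbb{C}$ with $V(0)=0$ and $V'(0)\ne0$. Let $D=d/dx$, $W(z)=1/V'(z)$ and $Y=xW(D)$, and let $U$ be an open neighborhood of $0$ on which $V$ is holomorphic and $V'$ does not vanish. Then $$[V(D),Y]=I,$$ where $I$ is the identity operator. The identity holds as operators acting on polynomials in $x$, and on the functions $x^k e^{Ax}$ ($k\ge0$, $A\in U$).
   Context: For $f$ holomorphic on $U$, the operator $f(D)$ acts on the linear span of the functions $x^k e^{Ax}$ ($k\ge 0$, $A\in U$) by $f(D)\,(x^k e^{Ax})=\partial_A^k\bigl(f(A)e^{Ax}\bigr)$. In particular $f(D)e^{Ax}=f(A)e^{Ax}$, and on polynomials (the case $A=0$) $f(D)$ is the finitely acting power series $\sum_j \frac{f^{(j)}(0)}{j!}D^j$. The symbol $x$ also denotes the operator of multiplication by $x$, so $Y=xW(D)$ means: first apply $W(D)$, then multiply by $x$. The commutator is $[P,Q]=PQ-QP$. *)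

theory Defs
  imports
    "HOL-Complex_Analysis.Complex_Analysis"
    "HOL-Computational_Algebra.Polynomial"
    "HOL-Library.Function_Algebras"
begin

definition scale_fun :: "complex \<Rightarrow> (complex \<Rightarrow> complex) \<Rightarrow> complex \<Rightarrow> complex" where
  "scale_fun c F = (\<lambda>x. c * F x)"

global_interpretation cfun: vector_space scale_fun
  by unfold_locales (auto simp: scale_fun_def algebra_simps)

definition exp_monomial :: "nat \<Rightarrow> complex \<Rightarrow> complex \<Rightarrow> complex" where
  "exp_monomial k A = (\<lambda>x. x ^ k * exp (A * x))"

definition exp_monomials :: "complex set \<Rightarrow> (complex \<Rightarrow> complex) set" where
  "exp_monomials U = {exp_monomial k A | k A. A \<in> U}"

(* The function to which f(D) sends exp_monomial k A: the k-th derivative of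
   a \<mapsto> f a * exp (a * x) at a = A. *)
definition op_D_image :: "(complex \<Rightarrow> complex) \<Rightarrow> nat \<Rightarrow> complex \<Rightarrow> complex \<Rightarrow> complex" where
  "op_D_image f k A = (\<lambda>x. (deriv ^^ k) (\<lambda>a. f a * exp (a * x)) A)"

(* The linear extension of exp_monomial k A \<mapsto> op_D_image f k A to the span of exp_monomials U.
   The exp_monomials are linearly independent and pairwise distinct (lemmas
   independent_exp_monomials and exp_monomial_eq_iff below), so cfun.representation gives the
   coordinates of F; lemmas op_D_exp_monomial, op_D_add and op_D_scale are the defining
   properties of f(D). Outside the span the value is the junk value 0. *)
definition op_D :: "complex set \<Rightarrow> (complex \<Rightarrow> complex) \<Rightarrow> (complex \<Rightarrow> complex) \<Rightarrow> complex \<Rightarrow> complex" where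
  "op_D U f F = (\<lambda>x. \<Sum>(k, A) | A \<in> U \<and> cfun.representation (exp_monomials U) F (exp_monomial k A) \<noteq> 0.
      cfun.representation (exp_monomials U) F (exp_monomial k A) * op_D_image f k A x)"

(* The power series of f at 0 in D = pderiv; the terms with j > degree p vanish. *)
definition poly_op_D :: "(complex \<Rightarrow> complex) \<Rightarrow> complex poly \<Rightarrow> complex poly" where
  "poly_op_D f p = (\<Sum>j\<le>degree p. smult ((deriv ^^ j) f 0 / fact j) ((pderiv ^^ j) p))"

definition mult_x :: "(complex \<Rightarrow> complex) \<Rightarrow> complex \<Rightarrow> complex" where
  "mult_x F = (\<lambda>x. x * F x)"

definition poly_mult_x :: "complex poly \<Rightarrow> complex poly" where
  "poly_mult_x p = [:0, 1:] * p"

definition commutator :: "('a \<Rightarrow> 'a) \<Rightarrow> ('a \<Rightarrow> 'a) \<Rightarrow> 'a \<Rightarrow> 'a::minus" where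
  "commutator P Q F = P (Q F) - Q (P F)"

definition shifted_pderiv :: "complex \<Rightarrow> complex poly \<Rightarrow> complex poly" where
  "shifted_pderiv b p = pderiv p + smult b p"

lemma shifted_pderiv_eq_0: "b \<noteq> 0 \<Longrightarrow> shifted_pderiv b p = 0 \<Longrightarrow> p = 0"
proof (rule ccontr)
  assume b: "b \<noteq> 0" and 0: "shifted_pderiv b p = 0" and p: "p \<noteq> 0"
  have "coeff (shifted_pderiv b p) (degree p) = b * lead_coeff p"
    by (simp add: shifted_pderiv_def coeff_pderiv coeff_eq_0)
  with b 0 p show False by simp
qed

lemma funpow_shifted_pderiv_eq_0: "b \<noteq> 0 \<Longrightarrow> (shifted_pderiv b ^^ n) p = 0 \<Longrightarrow> p = 0"
  by (induction n) (auto dest: shifted_pderiv_eq_0)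

lemma funpow_pderiv_eq_0: "degree p < n \<Longrightarrow> (pderiv ^^ n) (p::complex poly) = 0"
proof (induction n arbitrary: p)
  case (Suc n)
  show ?case
  proof (cases "degree p = 0")
    case True
    then have "pderiv p = 0" by (simp add: pderiv_eq_0_iff)
    moreover have "(pderiv ^^ m) (0::complex poly) = 0" for m by (induction m) auto
    ultimately show ?thesis by (simp add: funpow_Suc_right del: funpow.simps)
  next
    case False
    with Suc show ?thesis by (simp add: funpow_Suc_right degree_pderiv del: funpow.simps)
  qed
qed simp

lemma exp_sum_shifted_pderiv:
  fixes b :: "complex \<Rightarrow> complex"
  assumes "\<And>x. (\<Sum>A\<in>T. poly (p A) x * exp (b A * x)) = 0"
  shows "(\<Sum>A\<in>T. poly (shifted_pderiv (b A) (p A)) x * exp (b A * x)) = 0"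
proof -
  have "((\<lambda>x. \<Sum>A\<in>T. poly (p A) x * exp (b A * x)) has_field_derivative
      (\<Sum>A\<in>T. poly (shifted_pderiv (b A) (p A)) x * exp (b A * x))) (at x)"
    by (auto intro!: derivative_eq_intros sum.cong simp: shifted_pderiv_def algebra_simps)
  moreover have "((\<lambda>x. \<Sum>A\<in>T. poly (p A) x * exp (b A * x)) has_field_derivative 0) (at x)"
    by (simp add: assms)
  ultimately show ?thesis by (rule DERIV_unique)
qed

lemma exp_sum_eq_0:
  fixes T :: "complex set"
  assumes "finite T" "\<And>x. (\<Sum>A\<in>T. poly (p A) x * exp (A * x)) = 0" "A \<in> T"
  shows "p A = 0"
  using assms
proof (induction T arbitrary: p A rule: finite_induct)
  case (insert B T)
  define L where "L n C = (shifted_pderiv (C - B) ^^ n) (p C)" for n C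
  have "(\<Sum>C\<in>insert B T. poly (p C) x * exp ((C - B) * x)) = 0" for x
  proof -
    have "(\<Sum>C\<in>insert B T. poly (p C) x * exp ((C - B) * x))
        = exp (- B * x) * (\<Sum>C\<in>insert B T. poly (p C) x * exp (C * x))"
      unfolding sum_distrib_left
      by (intro sum.cong) (auto simp: exp_add [symmetric] algebra_simps exp_diff exp_minus field_simps)
    then show ?thesis using insert.prems by simp
  qed
  then have L: "(\<Sum>C\<in>insert B T. poly (L n C) x * exp ((C - B) * x)) = 0" for n x
  proof (induction n arbitrary: x)
    case (Suc n)
    from exp_sum_shifted_pderiv [where b = "\<lambda>C. C - B", OF Suc.IH [OF Suc.prems]]
    show ?case by (simp add: L_def)
  qed (simp add: L_def)
  define n where "n = Suc (degree (p B))"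
  have "shifted_pderiv 0 = pderiv" by (simp add: fun_eq_iff shifted_pderiv_def)
  then have LB: "L n B = 0" by (simp add: L_def n_def funpow_pderiv_eq_0 del: funpow.simps)
  have "L n C = 0" if "C \<in> T" for C
  proof (rule insert.IH [OF _ that])
    fix x
    have "(\<Sum>C\<in>T. poly (L n C) x * exp (C * x))
        = exp (B * x) * (\<Sum>C\<in>insert B T. poly (L n C) x * exp ((C - B) * x))"
      using insert.hyps LB
      by (simp add: sum_distrib_left algebra_simps exp_diff)
    then show "(\<Sum>C\<in>T. poly (L n C) x * exp (C * x)) = 0" using L by simp
  qed
  then have T: "p C = 0" if "C \<in> T" for C
    using that insert.hyps funpow_shifted_pderiv_eq_0 [of "C - B" n "p C"] by (auto simp: L_def)
  have "poly (p B) x = 0" for x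
    using insert.prems(1) [of x] insert.hyps T by simp
  then have "p B = 0" by (simp add: poly_eq_poly_eq_iff [symmetric] fun_eq_iff)
  with T insert.prems show ?case by auto
qed simp

lemma exp_monomial_sum_eq_0:
  assumes J: "finite J" and 0: "(\<Sum>(k, A)\<in>J. scale_fun (u k A) (exp_monomial k A)) = 0"
    and kA: "(k, A) \<in> J"
  shows "u k A = 0"
proof -
  define p where "p A = (\<Sum>(l, B)\<in>{i\<in>J. snd i = A}. monom (u l B) l)" for A
  have "(\<Sum>A\<in>snd ` J. poly (p A) x * exp (A * x)) = 0" for x
  proof -
    have "(\<Sum>A\<in>snd ` J. poly (p A) x * exp (A * x))
        = (\<Sum>A\<in>snd ` J. \<Sum>(l, B)\<in>{i\<in>J. snd i = A}. u l B * exp_monomial l B x)"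
      by (auto intro!: sum.cong simp: p_def poly_sum sum_distrib_left exp_monomial_def poly_monom
          split_def ac_simps)
    also have "\<dots> = (\<Sum>(l, B)\<in>J. u l B * exp_monomial l B x)"
      using J by (intro sum.group) auto
    also have "\<dots> = (\<Sum>(l, B)\<in>J. scale_fun (u l B) (exp_monomial l B)) x"
      using J by (induction J) (auto simp: scale_fun_def)
    finally show ?thesis using 0 by simp
  qed
  then have "p A = 0"
    using exp_sum_eq_0 [of "snd ` J" p A] J kA by force
  moreover have "coeff (p A) k = (\<Sum>i\<in>{i\<in>J. snd i = A}. if i = (k, A) then u k A else 0)"
    by (auto simp: p_def coeff_sum intro!: sum.cong split: prod.splits)
  moreover have "\<dots> = u k A" using J kA by simp
  ultimately show ?thesis by simp
qed

lemma exp_monomial_eq_iff: "exp_monomial k A = exp_monomial l B \<longleftrightarrow> k = l \<and> A = B"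
proof (rule ccontr)
  assume "\<not> ?thesis"
  then have neq: "(k, A) \<noteq> (l, B)" and eq: "exp_monomial k A = exp_monomial l B" by auto
  define u :: "nat \<Rightarrow> complex \<Rightarrow> complex" where "u m C = (if (m, C) = (k, A) then 1 else -1)" for m C
  have "scale_fun 1 F + scale_fun (-1) F = 0" for F by (simp add: scale_fun_def fun_eq_iff)
  with neq have "(\<Sum>(m, C)\<in>{(k, A), (l, B)}. scale_fun (u m C) (exp_monomial m C)) = 0"
    by (auto simp: u_def eq [symmetric])
  from exp_monomial_sum_eq_0 [where u = u, OF _ this, of k A] have "u k A = 0" by simp
  then show False by (simp add: u_def)
qed

lemma independent_exp_monomials: "\<not> cfun.dependent (exp_monomials U)"
  unfolding cfun.independent_explicit_finite_subsets
proof (intro allI impI)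
  fix S and u :: "(complex \<Rightarrow> complex) \<Rightarrow> complex"
  assume S: "S \<subseteq> exp_monomials U" "finite S" and 0: "(\<Sum>v\<in>S. scale_fun (u v) v) = 0"
  define e where "e = (\<lambda>(k, A). exp_monomial k A)"
  have inj: "inj e" by (auto simp: inj_def e_def exp_monomial_eq_iff)
  define J where "J = e -` S"
  have J: "finite J" using inj S by (simp add: J_def finite_vimageI)
  have "exp_monomials U \<subseteq> range e" by (auto simp: e_def exp_monomials_def image_def)
  with S(1) have "S = e ` J" unfolding J_def image_vimage_eq by (simp add: Int_absorb2)
  then have "(\<Sum>v\<in>S. scale_fun (u v) v) = (\<Sum>(k, A)\<in>J. scale_fun (u (exp_monomial k A)) (exp_monomial k A))"
    using inj by (simp add: sum.reindex inj_on_subset e_def split_def)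
  from this [symmetric] 0 have sum: "(\<Sum>(k, A)\<in>J. scale_fun (u (exp_monomial k A)) (exp_monomial k A)) = 0"
    by (rule trans)
  show "\<forall>v\<in>S. u v = 0"
  proof
    fix v assume v: "v \<in> S"
    from v S obtain k A where v_eq: "v = exp_monomial k A" by (auto simp: exp_monomials_def)
    with v have "(k, A) \<in> J" by (simp add: J_def e_def)
    from exp_monomial_sum_eq_0 [where u = "\<lambda>k A. u (exp_monomial k A)", OF J sum this]
    show "u v = 0" unfolding v_eq .
  qed
qed

lemma op_D_eq_sum:
  assumes "finite J"
    and "\<And>k A. A \<in> U \<Longrightarrow> cfun.representation (exp_monomials U) F (exp_monomial k A) \<noteq> 0 \<Longrightarrow> (k, A) \<in> J"
    and "J \<subseteq> UNIV \<times> U"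
  shows "op_D U f F x =
    (\<Sum>(k, A)\<in>J. cfun.representation (exp_monomials U) F (exp_monomial k A) * op_D_image f k A x)"
  unfolding op_D_def using assms by (intro sum.mono_neutral_left) auto

lemma finite_op_D_support:
  "finite {(k, A). A \<in> U \<and> cfun.representation (exp_monomials U) F (exp_monomial k A) \<noteq> 0}"
proof -
  have "inj (\<lambda>(k, A). exp_monomial k A)" by (auto simp: inj_def exp_monomial_eq_iff)
  moreover have "finite {b. cfun.representation (exp_monomials U) F b \<noteq> 0}"
    by (rule cfun.finite_representation)
  ultimately have "finite ((\<lambda>(k, A). exp_monomial k A) -`
      {b. cfun.representation (exp_monomials U) F b \<noteq> 0})"
    by (rule finite_vimageI [rotated])
  then show ?thesis by (rule rev_finite_subset) auto
qed

lemma op_D_exp_monomial: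
  assumes "A \<in> U"
  shows "op_D U f (exp_monomial k A) = op_D_image f k A"
proof
  fix x
  have "exp_monomial k A \<in> exp_monomials U" using assms by (auto simp: exp_monomials_def)
  then have rep: "cfun.representation (exp_monomials U) (exp_monomial k A)
      = (\<lambda>b. if b = exp_monomial k A then 1 else 0)"
    using cfun.representation_basis [OF independent_exp_monomials] by auto
  show "op_D U f (exp_monomial k A) x = op_D_image f k A x"
    by (subst op_D_eq_sum [of "{(k, A)}"]) (use assms in \<open>auto simp: rep exp_monomial_eq_iff split: if_splits\<close>)
qed

lemma op_D_add:
  assumes "F \<in> cfun.span (exp_monomials U)" "G \<in> cfun.span (exp_monomials U)"
  shows "op_D U f (F + G) = op_D U f F + op_D U f G"
proof
  fix x
  let ?N = "\<lambda>F. {(k, A). A \<in> U \<and> cfun.representation (exp_monomials U) F (exp_monomial k A) \<noteq> 0}"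
  let ?J = "?N F \<union> ?N G"
  have rep: "cfun.representation (exp_monomials U) (F + G)
      = (\<lambda>b. cfun.representation (exp_monomials U) F b + cfun.representation (exp_monomials U) G b)"
    using cfun.representation_add [OF independent_exp_monomials] assms
    by blast
  have *: "op_D U f H x = (\<Sum>(k, A)\<in>?J. cfun.representation (exp_monomials U) H (exp_monomial k A) * op_D_image f k A x)"
    if "H \<in> {F, G, F + G}" for H
    using that finite_op_D_support by (intro op_D_eq_sum) (auto simp: rep)
  show "op_D U f (F + G) x = (op_D U f F + op_D U f G) x"
    by (simp add: * rep sum.distrib [symmetric] split_def algebra_simps)
qed

lemma op_D_scale:
  assumes "F \<in> cfun.span (exp_monomials U)"
  shows "op_D U f (scale_fun c F) = scale_fun c (op_D U f F)"
proof
  fix x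
  have rep: "cfun.representation (exp_monomials U) (scale_fun c F)
      = (\<lambda>b. c * cfun.representation (exp_monomials U) F b)"
    using cfun.representation_scale [OF independent_exp_monomials] assms
    by blast
  let ?J = "{(k, A). A \<in> U \<and> cfun.representation (exp_monomials U) F (exp_monomial k A) \<noteq> 0}"
  have *: "op_D U f H x = (\<Sum>(k, A)\<in>?J. cfun.representation (exp_monomials U) H (exp_monomial k A) * op_D_image f k A x)"
    if "H \<in> {F, scale_fun c F}" for H
    using that finite_op_D_support by (intro op_D_eq_sum) (auto simp: rep)
  show "op_D U f (scale_fun c F) x = scale_fun c (op_D U f F) x"
    by (simp add: * rep) (simp add: * scale_fun_def sum_distrib_left split_def algebra_simps)
qed

lemma op_D_zero: "op_D U f 0 = 0"
  using op_D_scale [of 0 U f 0, OF cfun.span_zero] by simp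

lemma poly_op_D_eq_sum:
  assumes "degree p \<le> n"
  shows "poly_op_D f p = (\<Sum>j\<le>n. smult ((deriv ^^ j) f 0 / fact j) ((pderiv ^^ j) p))"
  unfolding poly_op_D_def using assms
  by (intro sum.mono_neutral_left) (auto simp: funpow_pderiv_eq_0)

lemma poly_op_D_add: "poly_op_D f (p + q) = poly_op_D f p + poly_op_D f q"
proof -
  let ?n = "max (degree p) (degree q)"
  have "degree (p + q) \<le> ?n" by (rule degree_add_le_max)
  then show ?thesis
    by (simp add: poly_op_D_eq_sum [of _ ?n] higher_pderiv_add smult_add_right sum.distrib)
qed

lemma op_D_image_0:
  assumes "f holomorphic_on U" "open U" "0 \<in> U"
  shows "op_D_image f k 0 x = (\<Sum>j\<le>k. of_nat (k choose j) * (deriv ^^ j) f 0 * x ^ (k - j))"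
proof -
  have exp: "(deriv ^^ n) (\<lambda>a. exp (a * x)) = (\<lambda>a. x ^ n * exp (a * x))" for n
  proof (induction n)
    case (Suc n)
    have "((\<lambda>a. x ^ n * exp (a * x)) has_field_derivative x ^ Suc n * exp (a * x)) (at a)" for a
      by (auto intro!: derivative_eq_intros)
    with Suc show ?case by (auto intro!: DERIV_imp_deriv)
  qed simp
  have "(\<lambda>a. exp (a * x)) holomorphic_on U" by (intro holomorphic_intros)
  from higher_deriv_mult [OF assms(1) this assms(2,3), of k] show ?thesis
    by (simp add: op_D_image_def exp atLeast0AtMost)
qed

lemma poly_poly_op_D_monom:
  "poly (poly_op_D f (monom c k)) x
    = c * (\<Sum>j\<le>k. of_nat (k choose j) * (deriv ^^ j) f 0 * x ^ (k - j))"
proof -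
  have "(pderiv ^^ j) (monom c k) = monom (fact j * of_nat (k choose j) * c) (k - j)" if "j \<le> k" for j
  proof (rule poly_eqI)
    fix n
    have "pochhammer (of_nat (Suc n)) j = (fact j * of_nat (n + j choose j) :: complex)"
      by (simp add: binomial_gbinomial gbinomial_pochhammer' algebra_simps)
    with that show "coeff ((pderiv ^^ j) (monom c k)) n
        = coeff (monom (fact j * of_nat (k choose j) * c) (k - j)) n"
      by (auto simp: coeff_higher_pderiv)
  qed
  then show ?thesis
    by (simp add: poly_op_D_eq_sum [of _ k] degree_monom_le poly_sum poly_monom sum_distrib_left
        algebra_simps)
qed

lemma op_D_poly:
  assumes "f holomorphic_on U" "open U" "0 \<in> U"
  shows "op_D U f (poly p) = poly (poly_op_D f p)"
proof -
  have monom: "poly (monom c k) = scale_fun c (exp_monomial k 0)" for c k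
    by (simp add: fun_eq_iff poly_monom scale_fun_def exp_monomial_def)
  have base: "exp_monomial k 0 \<in> cfun.span (exp_monomials U)" for k
    using assms(3) by (intro cfun.span_base) (auto simp: exp_monomials_def)
  define P where
    "P p \<longleftrightarrow> poly p \<in> cfun.span (exp_monomials U) \<and> op_D U f (poly p) = poly (poly_op_D f p)" for p
  have "P (monom c k)" for c k
    unfolding P_def
  proof
    show "poly (monom c k) \<in> cfun.span (exp_monomials U)"
      unfolding monom by (intro cfun.span_scale base)
    show "op_D U f (poly (monom c k)) = poly (poly_op_D f (monom c k))"
      by (simp add: monom op_D_scale base op_D_exp_monomial assms(3))
        (simp add: fun_eq_iff scale_fun_def op_D_image_0 [OF assms] poly_poly_op_D_monom)
  qed
  moreover have "P (p + q)" if "P p" "P q" for p q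
  proof -
    have add: "poly (r + s) = poly r + poly s" for r s :: "complex poly" by (simp add: fun_eq_iff)
    from that show ?thesis
      unfolding P_def add poly_op_D_add by (simp add: cfun.span_add op_D_add)
  qed
  moreover have "P 0"
  proof -
    have "poly 0 = (0 :: complex \<Rightarrow> complex)" by (simp add: fun_eq_iff)
    then show ?thesis by (simp add: P_def cfun.span_zero op_D_zero poly_op_D_def)
  qed
  ultimately have "P (\<Sum>i\<le>n. monom (coeff p i) i)" for n
    by (induction n) auto
  from this [of "degree p"] show ?thesis
    by (simp add: poly_as_sum_of_monoms P_def)
qed

end

theory Submission
  imports Defs
begin

text \<open>Write \<open>E\<close> for \<open>a \<mapsto> exp (a * x)\<close> and \<open>\<partial>\<close> for \<open>d/da\<close>. By the Leibniz rule \<open>f(D)\<close> maps \<open>\<partial>\<^sup>k (g E)\<close> to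
  \<open>\<partial>\<^sup>k (f g E)\<close>, and multiplication by \<open>x\<close> maps it to \<open>\<partial>\<^sup>k (g x E) = \<partial>\<^sup>k\<^sup>+\<^sup>1 (g E) - \<partial>\<^sup>k (g' E)\<close>.
  Hence the commutator of \<open>V(D)\<close> and \<open>x W(D)\<close> maps \<open>\<partial>\<^sup>k E\<close> to
  \<open>\<partial>\<^sup>k (((V W)' - V W') E) = \<partial>\<^sup>k (V' W E) = \<partial>\<^sup>k E\<close>.
  The polynomial case is the restriction to exponent \<open>0\<close>.\<close>

lemma sum_fun_apply: "(\<Sum>i\<in>I. h i) x = (\<Sum>i\<in>I. h i x)"
  for h :: "'i \<Rightarrow> 'b \<Rightarrow> 'a :: comm_monoid_add"
  by (induction I rule: infinite_finite_induct) auto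

lemma exp_monomial_in_span: "A \<in> U \<Longrightarrow> exp_monomial k A \<in> cfun.span (exp_monomials U)"
  by (intro cfun.span_base) (auto simp: exp_monomials_def)

lemma higher_deriv_exp_times: "(deriv ^^ n) (\<lambda>a. exp (a * x)) = (\<lambda>a. x ^ n * exp (a * x :: complex))"
proof (induction n)
  case (Suc n)
  have "((\<lambda>a. x ^ n * exp (a * x)) has_field_derivative x ^ Suc n * exp (a * x)) (at a)" for a
    by (auto intro!: derivative_eq_intros)
  with Suc show ?case by (auto intro!: DERIV_imp_deriv)
qed simp

text \<open>Leibniz's rule for \<open>f\<close> times the exponential, whose derivatives in the
  exponent only produce powers of \<open>x\<close>. The coordinates obtained in this way make it
  possible to apply a further \<open>op_D\<close> term by term.\<close>

lemma op_D_image_eq_sum: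
  assumes "f holomorphic_on U" "open U" "A \<in> U"
  shows "op_D_image f k A =
    (\<Sum>j\<le>k. scale_fun (of_nat (k choose j) * (deriv ^^ j) f A) (exp_monomial (k - j) A))"
proof
  fix x
  have "(\<lambda>a. exp (a * x)) holomorphic_on U" by (intro holomorphic_intros)
  from higher_deriv_mult [OF assms(1) this assms(2,3), of k]
  show "op_D_image f k A x =
    (\<Sum>j\<le>k. scale_fun (of_nat (k choose j) * (deriv ^^ j) f A) (exp_monomial (k - j) A)) x"
    by (simp add: op_D_image_def higher_deriv_exp_times atLeast0AtMost sum_fun_apply scale_fun_def
        exp_monomial_def mult.assoc)
qed

lemma op_D_image_in_span:
  assumes "f holomorphic_on U" "open U" "A \<in> U"
  shows "op_D_image f k A \<in> cfun.span (exp_monomials U)"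
  unfolding op_D_image_eq_sum [OF assms]
  by (intro cfun.span_sum cfun.span_scale exp_monomial_in_span assms)

lemma op_D_sum:
  assumes "\<And>i. i \<in> I \<Longrightarrow> F i \<in> cfun.span (exp_monomials U)"
  shows "op_D U f (\<Sum>i\<in>I. F i) = (\<Sum>i\<in>I. op_D U f (F i))"
  using assms
  by (induction I rule: infinite_finite_induct) (auto simp: op_D_zero op_D_add cfun.span_sum)

lemma op_D_diff:
  assumes "F \<in> cfun.span (exp_monomials U)" "G \<in> cfun.span (exp_monomials U)"
  shows "op_D U f (F - G) = op_D U f F - op_D U f G"
  using op_D_add [OF cfun.span_diff [OF assms] assms(2), of f] by (simp add: algebra_simps)

lemma op_D_op_D_image:
  assumes f: "f holomorphic_on U" and g: "g holomorphic_on U" and U: "open U" "A \<in> U"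
  shows "op_D U f (op_D_image g k A) = op_D_image (\<lambda>a. f a * g a) k A"
proof
  fix x
  have "(\<lambda>a. f a * exp (a * x)) holomorphic_on U" by (intro holomorphic_intros f)
  \<comment> \<open>The factors are grouped as \<open>g\<close> and \<open>f E\<close>, not as
    \<open>f g\<close> and \<open>E\<close>: the derivatives of \<open>f E\<close> are then exactly
    the images under \<open>f(D)\<close> of the terms in the Leibniz expansion of
    \<open>op_D_image g k A\<close>.\<close>
  from higher_deriv_mult [OF g this U, of k]
  have "(\<Sum>j\<le>k. of_nat (k choose j) * (deriv ^^ j) g A * op_D_image f (k - j) A x) =
      op_D_image (\<lambda>a. f a * g a) k A x"
    by (simp add: op_D_image_def atLeast0AtMost mult_ac)
  then show "op_D U f (op_D_image g k A) x = op_D_image (\<lambda>a. f a * g a) k A x"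
    by (simp add: op_D_image_eq_sum [OF g U] op_D_sum op_D_scale op_D_exp_monomial
        exp_monomial_in_span cfun.span_scale U sum_fun_apply scale_fun_def [of _ "op_D_image _ _ _"])
qed

text \<open>Higher derivatives at \<open>A\<close> depend only on the germ at \<open>A\<close>, and
  \<open>U\<close> is a neighborhood of \<open>A\<close>.\<close>

lemma op_D_image_cong:
  assumes "open U" "A \<in> U" "\<And>a. a \<in> U \<Longrightarrow> f a = g a"
  shows "op_D_image f k A = op_D_image g k A"
proof
  fix x
  have "eventually (\<lambda>a. f a * exp (a * x) = g a * exp (a * x)) (nhds A)"
    using eventually_nhds_in_open [OF assms(1,2)] by eventually_elim (simp add: assms(3))
  then show "op_D_image f k A x = op_D_image g k A x"
    unfolding op_D_image_def by (intro higher_deriv_cong_ev refl)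
qed

lemma op_D_image_add:
  assumes "f holomorphic_on U" "g holomorphic_on U" "open U" "A \<in> U"
  shows "op_D_image (\<lambda>a. f a + g a) k A = op_D_image f k A + op_D_image g k A"
proof
  fix x
  have "(\<lambda>a. f a * exp (a * x)) holomorphic_on U" "(\<lambda>a. g a * exp (a * x)) holomorphic_on U"
    by (intro holomorphic_intros assms)+
  from higher_deriv_add [OF this assms(3,4), of k]
  show "op_D_image (\<lambda>a. f a + g a) k A x = (op_D_image f k A + op_D_image g k A) x"
    by (simp add: op_D_image_def distrib_right)
qed

text \<open>As \<partial>E = \<open>x E\<close>, the product rule gives
  \<partial>(\<open>g E\<close>) = \<open>g' E + x g E\<close>. Apply \<open>k\<close> more
  derivatives in the exponent; \<open>x\<close> is a constant for them.\<close>

lemma mult_x_op_D_image: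
  assumes g: "g holomorphic_on U" and U: "open U" "A \<in> U"
  shows "mult_x (op_D_image g k A) = op_D_image g (Suc k) A - op_D_image (deriv g) k A"
proof
  fix x
  let ?e = "\<lambda>a. exp (a * x) :: complex"
  have 1: "(\<lambda>a. deriv g a * ?e a) holomorphic_on U" "(\<lambda>a. g a * ?e a) holomorphic_on U"
    by (intro holomorphic_intros holomorphic_deriv g U)+
  have 2: "(\<lambda>a. x * (g a * ?e a)) holomorphic_on U" by (intro holomorphic_intros g)
  have "deriv (\<lambda>a. g a * ?e a) a = deriv g a * ?e a + x * (g a * ?e a)" if "a \<in> U" for a
    using holomorphic_derivI [OF g U(1) that]
    by (intro DERIV_imp_deriv) (auto intro!: derivative_eq_intros simp: algebra_simps)
  \<comment> \<open>The product rule is known only on \<open>U\<close>, so it is differentiated as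
    an identity near \<open>A\<close>.\<close>
  then have "eventually (\<lambda>a. deriv (\<lambda>a. g a * ?e a) a = deriv g a * ?e a + x * (g a * ?e a)) (nhds A)"
    using eventually_nhds_in_open [OF U] by (auto elim: eventually_mono)
  then have "(deriv ^^ k) (deriv (\<lambda>a. g a * ?e a)) A =
      (deriv ^^ k) (\<lambda>a. deriv g a * ?e a + x * (g a * ?e a)) A"
    by (intro higher_deriv_cong_ev refl)
  also have "\<dots> = (deriv ^^ k) (\<lambda>a. deriv g a * ?e a) A + x * (deriv ^^ k) (\<lambda>a. g a * ?e a) A"
    using higher_deriv_add [OF 1(1) 2 U] higher_deriv_cmult [OF 1(2) U(2,1)] by simp
  finally show "mult_x (op_D_image g k A) x = (op_D_image g (Suc k) A - op_D_image (deriv g) k A) x"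
    by (simp add: mult_x_def op_D_image_def funpow_Suc_right del: funpow.simps)
qed

lemma mult_x_exp_monomial: "mult_x (exp_monomial k A) = exp_monomial (Suc k) A"
  by (simp add: mult_x_def exp_monomial_def mult.assoc)

lemma mult_x_zero: "mult_x 0 = 0"
  by (simp add: mult_x_def fun_eq_iff)

lemma mult_x_add: "mult_x (F + G) = mult_x F + mult_x G"
  by (simp add: mult_x_def fun_eq_iff algebra_simps)

lemma mult_x_scale: "mult_x (scale_fun c F) = scale_fun c (mult_x F)"
  by (simp add: mult_x_def scale_fun_def fun_eq_iff)

text \<open>Unlike \<open>cfun.span_induct\<close>, this rule supplies membership in the span in the
  inductive cases. It is obtained by strengthening \<open>P\<close> with that membership, which
  \<open>op_D_add\<close> and \<open>op_D_scale\<close> require.\<close>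

lemma span_exp_monomials_induct [consumes 1, case_names zero add scale exp_monomial]:
  assumes "F \<in> cfun.span (exp_monomials U)"
    and "P 0"
    and "\<And>F G. F \<in> cfun.span (exp_monomials U) \<Longrightarrow> G \<in> cfun.span (exp_monomials U) \<Longrightarrow>
      P F \<Longrightarrow> P G \<Longrightarrow> P (F + G)"
    and "\<And>c F. F \<in> cfun.span (exp_monomials U) \<Longrightarrow> P F \<Longrightarrow> P (scale_fun c F)"
    and "\<And>k A. A \<in> U \<Longrightarrow> P (exp_monomial k A)"
  shows "P F"
proof -
  have "F \<in> cfun.span (exp_monomials U) \<and> P F"
    using assms(1)
  proof (induction rule: cfun.span_induct)
    case base
    then show ?case using assms(2-4)
      by (auto simp: cfun.subspace_def cfun.span_zero cfun.span_add cfun.span_scale)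
  next
    case (step F)
    then show ?case using assms(5) cfun.span_base [of F "exp_monomials U"] by (auto simp: exp_monomials_def)
  qed
  then show ?thesis ..
qed

text \<open>Needed for composing operators: \<open>op_D\<close> is the intended linear map only on
  the span and is 0 outside it.\<close>

lemma op_D_in_span:
  assumes "f holomorphic_on U" "open U" "F \<in> cfun.span (exp_monomials U)"
  shows "op_D U f F \<in> cfun.span (exp_monomials U)"
  using assms(3)
  by (induction rule: span_exp_monomials_induct)
    (simp_all add: op_D_zero op_D_add op_D_scale op_D_exp_monomial op_D_image_in_span assms
      cfun.span_zero cfun.span_add cfun.span_scale del: zero_fun_apply plus_fun_apply)

lemma mult_x_in_span:
  assumes "F \<in> cfun.span (exp_monomials U)"
  shows "mult_x F \<in> cfun.span (exp_monomials U)"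
  using assms
proof (induction rule: span_exp_monomials_induct)
  case zero
  show ?case by (simp add: mult_x_zero cfun.span_zero del: zero_fun_apply)
qed (simp_all add: mult_x_add mult_x_scale mult_x_exp_monomial exp_monomial_in_span
    cfun.span_add cfun.span_scale del: plus_fun_apply)

lemma commutator_exp_monomial:
  assumes V: "V holomorphic_on U" and W: "W holomorphic_on U" and U: "open U" "A \<in> U"
    and inv: "\<And>a. a \<in> U \<Longrightarrow> deriv V a * W a = 1"
  shows "commutator (op_D U V) (mult_x \<circ> op_D U W) (exp_monomial k A) = exp_monomial k A"
proof -
  let ?I = "\<lambda>f k. op_D_image f k A"
  note hol = V W holomorphic_deriv [OF V U(1)] holomorphic_deriv [OF W U(1)]
  have VW: "(\<lambda>a. V a * W a) holomorphic_on U" "(\<lambda>a. V a * deriv W a) holomorphic_on U"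
    by (intro holomorphic_intros hol)+
  \<comment> \<open>Here the multiplication by \<open>x\<close> precedes \<open>V(D)\<close>, so the
    correction term differentiates \<open>W\<close> alone.\<close>
  have "op_D U V (mult_x (op_D U W (exp_monomial k A))) =
      ?I (\<lambda>a. V a * W a) (Suc k) - ?I (\<lambda>a. V a * deriv W a) k"
    by (simp add: op_D_exp_monomial mult_x_op_D_image [OF W U] op_D_diff op_D_image_in_span
        op_D_op_D_image hol U)
  \<comment> \<open>Here \<open>V\<close> and \<open>W\<close> are already merged when
    \<open>x\<close> acts, so the whole product is differentiated. The terms of order
    \<open>Suc k\<close> agree and cancel in the commutator.\<close>
  moreover have "mult_x (op_D U W (op_D U V (exp_monomial k A))) =
      ?I (\<lambda>a. V a * W a) (Suc k) - ?I (deriv (\<lambda>a. V a * W a)) k"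
    by (simp add: op_D_exp_monomial op_D_op_D_image hol U mult.commute [of "W _"]
        mult_x_op_D_image [OF VW(1) U])
  moreover have "?I (deriv (\<lambda>a. V a * W a)) k = ?I (\<lambda>a. 1 + V a * deriv W a) k"
  proof (rule op_D_image_cong [OF U])
    fix a assume a: "a \<in> U"
    from holomorphic_derivI [OF V U(1) a] holomorphic_derivI [OF W U(1) a]
    have "((\<lambda>a. V a * W a) has_field_derivative deriv V a * W a + V a * deriv W a) (at a)"
      by (auto intro!: derivative_eq_intros)
    then show "deriv (\<lambda>a. V a * W a) a = 1 + V a * deriv W a"
      using inv [OF a] by (simp add: DERIV_imp_deriv)
  qed
  moreover have "\<dots> = ?I (\<lambda>_. 1) k + ?I (\<lambda>a. V a * deriv W a) k"
    by (intro op_D_image_add [where U = U] VW U) auto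
  moreover have "?I (\<lambda>_. 1) k = exp_monomial k A"
    by (simp add: op_D_image_def higher_deriv_exp_times exp_monomial_def)
  ultimately show ?thesis by (simp add: commutator_def)
qed

theorem proposition2p2:
  fixes V W :: "complex \<Rightarrow> complex" and U :: "complex set"
  assumes "open U" and "0 \<in> U"
    and "V holomorphic_on U"
    and "V 0 = 0" and "deriv V 0 \<noteq> 0"
    and "\<And>z. z \<in> U \<Longrightarrow> deriv V z \<noteq> 0"
    and "W = (\<lambda>z. 1 / deriv V z)"
  shows "(\<forall>p. commutator (poly_op_D V) (poly_mult_x \<circ> poly_op_D W) p = p) \<and>
    (\<forall>F \<in> cfun.span (exp_monomials U). commutator (op_D U V) (mult_x \<circ> op_D U W) F = F)"
proof (intro conjI allI ballI)
  note U = assms(1,2) and V = assms(3)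
  have W: "W holomorphic_on U"
    unfolding assms(7) by (intro holomorphic_intros V U assms(6))
  note in_span = op_D_in_span [OF V U(1)] op_D_in_span [OF W U(1)] mult_x_in_span
  \<comment> \<open>The second conjunct comes first because the polynomial case is deduced from
    it.\<close>
  show span: "commutator (op_D U V) (mult_x \<circ> op_D U W) F = F"
    if "F \<in> cfun.span (exp_monomials U)" for F
    using that
  proof (induction rule: span_exp_monomials_induct)
    case zero
    show ?case by (simp add: mult_x_zero commutator_def op_D_zero del: zero_fun_apply)
  next
    case (add F G)
    then have "commutator (op_D U V) (mult_x \<circ> op_D U W) (F + G) =
        commutator (op_D U V) (mult_x \<circ> op_D U W) F + commutator (op_D U V) (mult_x \<circ> op_D U W) G"
      by (simp add: commutator_def op_D_add mult_x_add in_span)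
    then show ?case by (simp only: add.IH)
  next
    case (scale c F)
    then have "commutator (op_D U V) (mult_x \<circ> op_D U W) (scale_fun c F) =
        scale_fun c (commutator (op_D U V) (mult_x \<circ> op_D U W) F)"
      by (simp add: commutator_def op_D_scale mult_x_scale in_span cfun.scale_right_diff_distrib)
    then show ?case by (simp only: scale.IH)
  next
    case (exp_monomial k A)
    show ?case
      using assms(6) by (intro commutator_exp_monomial V W U(1) exp_monomial) (simp add: assms(7))
  qed
  fix p
  have poly_x: "mult_x (poly q) = poly (poly_mult_x q)" for q
    by (simp add: mult_x_def poly_mult_x_def fun_eq_iff)
  \<comment> \<open>Polynomials are combinations of exponential monomials with exponent 0, and 0
    lies in \<open>U\<close>.\<close>
  have poly_eq: "poly q = (\<Sum>i\<le>degree q. scale_fun (coeff q i) (exp_monomial i 0))" for q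
  proof
    fix x
    show "poly q x = (\<Sum>i\<le>degree q. scale_fun (coeff q i) (exp_monomial i 0)) x"
      by (simp add: poly_altdef sum_fun_apply scale_fun_def exp_monomial_def)
  qed
  have "poly p \<in> cfun.span (exp_monomials U)"
    unfolding poly_eq by (intro cfun.span_sum cfun.span_scale exp_monomial_in_span U)
  from span [OF this]
  \<comment> \<open>\<open>op_D_poly\<close> and \<open>poly_x\<close> carry the operators over from
    functions to polynomials; a complex polynomial is determined by its values.\<close>
  have "poly (commutator (poly_op_D V) (poly_mult_x \<circ> poly_op_D W) p) = poly p"
    by (simp add: commutator_def op_D_poly V W U poly_x fun_eq_iff)
  then show "commutator (poly_op_D V) (poly_mult_x \<circ> poly_op_D W) p = p"
    by (simp add: poly_eq_poly_eq_iff)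
qed

end
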